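(* If the exact cost of the minimum spanning tree of a set of points in $\ell_\infty^d$ with $d=100\log n$ can be computed in a constant number of rounds in the MPC model, then one can also decide whether a general graph $G$ with $n$ vertices and $O(n)$ edges is connected in a constant number of rounds in the MPC model.
   Context: MPC model: input size $n$; $m$ machines each with space $s$ (polynomial in $n$), $m\cdot s=O(n)$; computation proceeds in rounds of local computation followed by communication, with each machine sending and receiving at most $s$ words per round. $\ell_\infty^d$ is $\mathbb{R}^d$ with the distance $\|x-y\|_\infty=\max_i|x_i-y_i|$; the MST cost is the total $\ell_\infty$-length of a minimum spanning tree of the complete graph on the points. *)

theory Defs
  imports Complex_Main
begin

section \<open>The MPC model\<close>

text \<open>
  A word is a natural number below \<open>2 ^ word_bits\<close>; a memory or a message is a list of words.
  Local computation is an arbitrary function of the local memory, as usual in the MPC model;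
  only memory and communication are limited. In round \<open>r\<close>, machine \<open>i\<close> with memory \<open>x\<close> sends the
  message \<open>send r i x j\<close> to machine \<open>j\<close>, and then replaces its memory by \<open>update r i x inbox\<close>,
  where \<open>inbox j\<close> is the message received from machine \<open>j\<close>. The result is read off from the
  final memory of machine 0.
\<close>

record 'o mpc =
  num_machines :: nat
  mem_words :: nat
  word_bits :: nat
  num_rounds :: nat
  send :: "nat \<Rightarrow> nat \<Rightarrow> nat list \<Rightarrow> nat \<Rightarrow> nat list"
  update :: "nat \<Rightarrow> nat \<Rightarrow> nat list \<Rightarrow> (nat \<Rightarrow> nat list) \<Rightarrow> nat list"
  result :: "nat list \<Rightarrow> 'o"

text \<open>
  The input is a list of items, each item being encoded by a list of words. The items are
  distributed evenly: item \<open>j\<close> initially resides on machine \<open>j mod num_machines A\<close>.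
\<close>

primrec memory :: "'o mpc \<Rightarrow> nat list list \<Rightarrow> nat \<Rightarrow> nat \<Rightarrow> nat list" where
  "memory A input 0 = (\<lambda>i. concat (nths input {j. j mod num_machines A = i}))"
| "memory A input (Suc r) = (\<lambda>i. update A r i (memory A input r i)
     (\<lambda>j. if j < num_machines A then send A r j (memory A input r j) i else []))"

definition message :: "'o mpc \<Rightarrow> nat list list \<Rightarrow> nat \<Rightarrow> nat \<Rightarrow> nat \<Rightarrow> nat list" where
  "message A input r i j = send A r i (memory A input r i) j"

definition is_words :: "'o mpc \<Rightarrow> nat list \<Rightarrow> bool" where
  "is_words A xs \<longleftrightarrow> (\<forall>x\<in>set xs. x < 2 ^ word_bits A)"

definition respects_limits :: "'o mpc \<Rightarrow> nat list list \<Rightarrow> bool" where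
  "respects_limits A input \<longleftrightarrow>
     (\<forall>r\<le>num_rounds A. \<forall>i<num_machines A.
        is_words A (memory A input r i) \<and> length (memory A input r i) \<le> mem_words A) \<and>
     (\<forall>r<num_rounds A. \<forall>i<num_machines A.
        (\<forall>j<num_machines A. is_words A (message A input r i j)) \<and>
        (\<Sum>j<num_machines A. length (message A input r i j)) \<le> mem_words A \<and>
        (\<Sum>j<num_machines A. length (message A input r j i)) \<le> mem_words A)"

definition computes :: "'o mpc \<Rightarrow> nat list list \<Rightarrow> 'o \<Rightarrow> bool" where
  "computes A input y \<longleftrightarrow>
     respects_limits A input \<and> result A (memory A input (num_rounds A) 0) = y"

text \<open>
  A computational problem is given by a family, indexed by size parameters \<open>p \<in> P\<close>, of sets
  \<open>task p\<close> of pairs (list of input items, correct answer); \<open>enc p w\<close> encodes an item by words of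
  \<open>w\<close> bits, and \<open>sz p\<close> is the input size \<open>n\<close>. It is solvable in a constant number of rounds with
  space exponent \<open>\<alpha>\<close> if this is possible with \<open>s = \<Theta>(n\<^sup>\<alpha>)\<close> words of \<open>\<Theta>(log n)\<close> bits per
  machine and \<open>m \<cdot> s = O(n)\<close>. The algorithm may depend on \<open>p\<close>, the constants may not.
\<close>

definition constant_rounds ::
    "real \<Rightarrow> 'p set \<Rightarrow> ('p \<Rightarrow> nat) \<Rightarrow> ('p \<Rightarrow> nat \<Rightarrow> 'x \<Rightarrow> nat list) \<Rightarrow>
     ('p \<Rightarrow> ('x list \<times> 'o) set) \<Rightarrow> bool" where
  "constant_rounds \<alpha> P sz enc task \<longleftrightarrow>
     (\<exists>(C::real) (R::nat). \<forall>p\<in>P. \<exists>A :: 'o mpc.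
        num_machines A \<ge> 1 \<and>
        real (sz p) powr \<alpha> \<le> real (mem_words A) \<and>
        real (mem_words A) \<le> C * real (sz p) powr \<alpha> \<and>
        real (num_machines A) * real (mem_words A) \<le> C * real (sz p) \<and>
        log 2 (real (sz p)) \<le> real (word_bits A) \<and>
        real (word_bits A) \<le> C * log 2 (real (sz p)) \<and>
        num_rounds A \<le> R \<and>
        (\<forall>(xs, y) \<in> task p. computes A (map (enc p (word_bits A)) xs) y))"


section \<open>Undirected graphs and spanning trees\<close>

text \<open>Edges of a graph are two-element sets of vertices.\<close>

definition complete_edges :: "'a set \<Rightarrow> 'a set set" where
  "complete_edges V = {{u, v} | u v. u \<in> V \<and> v \<in> V \<and> u \<noteq> v}"

definition connected_graph :: "'a set \<Rightarrow> 'a set set \<Rightarrow> bool" where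
  "connected_graph V E \<longleftrightarrow> (\<forall>u\<in>V. \<forall>v\<in>V. (u, v) \<in> {(x, y). {x, y} \<in> E}\<^sup>*)"

definition has_cycle :: "'a set set \<Rightarrow> bool" where
  "has_cycle E \<longleftrightarrow> (\<exists>c. length c \<ge> 3 \<and> distinct c \<and>
     (\<forall>i<length c. {c ! i, c ! (Suc i mod length c)} \<in> E))"

definition spanning_tree :: "'a set \<Rightarrow> 'a set set \<Rightarrow> bool" where
  "spanning_tree V T \<longleftrightarrow> T \<subseteq> complete_edges V \<and> connected_graph V T \<and> \<not> has_cycle T"


section \<open>Minimum spanning trees in \<open>\<ell>\<^sub>\<infinity>\<^sup>d\<close>\<close>

text \<open>Points of \<open>\<real>\<^sup>d\<close> are real lists of length \<open>d\<close>.\<close>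

definition linf_dist :: "real list \<Rightarrow> real list \<Rightarrow> real" where
  "linf_dist x y = Max ((\<lambda>i. \<bar>x ! i - y ! i\<bar>) ` {..<length x})"

definition edge_length :: "real list set \<Rightarrow> real" where
  "edge_length e = (THE l. \<exists>x y. e = {x, y} \<and> l = linf_dist x y)"

definition total_length :: "real list set set \<Rightarrow> real" where
  "total_length T = (\<Sum>e\<in>T. edge_length e)"

definition mst_cost :: "real list set \<Rightarrow> real" where
  "mst_cost P = total_length (arg_min total_length (spanning_tree P))"


section \<open>The two problems\<close>

definition mst_dim :: "nat \<Rightarrow> nat" where
  "mst_dim N = nat \<lceil>100 * log 2 (real N)\<rceil>"

text \<open>
  Size parameters \<open>(N, b)\<close>: \<open>N\<close> distinct points, whose coordinates are signed \<open>b\<close>-bit integers.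
  A point is the string of the \<open>b\<close>-bit two's complement representations of its coordinates, cut
  into words of \<open>w\<close> bits. The input size is the total number \<open>N \<cdot> d \<cdot> b\<close> of bits counted in words
  of \<open>log N\<close> bits; it is \<open>\<Theta>(N \<cdot> b)\<close> because \<open>d = \<lceil>100 log N\<rceil>\<close>.
\<close>

definition mst_instances :: "nat \<times> nat \<Rightarrow> int list list set" where
  "mst_instances = (\<lambda>(N, b). {ps. length ps = N \<and> distinct ps \<and>
     (\<forall>x\<in>set ps. length x = mst_dim N \<and> set x \<subseteq> {- (2 ^ (b - 1)) ..< 2 ^ (b - 1)})})"

definition mst_size :: "nat \<times> nat \<Rightarrow> nat" where
  "mst_size = (\<lambda>(N, b). nat \<lceil>real (N * mst_dim N * b) / log 2 (real N)\<rceil>)"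

definition encode_point :: "nat \<times> nat \<Rightarrow> nat \<Rightarrow> int list \<Rightarrow> nat list" where
  "encode_point = (\<lambda>(N, b) w x.
     (let X = nat (horner_sum (take_bit b) (2 ^ b) x)
      in map (\<lambda>q. take_bit w (drop_bit (w * q) X)) [0 ..< nat \<lceil>real (length x * b) / real w\<rceil>]))"

definition mst_task :: "nat \<times> nat \<Rightarrow> (int list list \<times> real) set" where
  "mst_task p = {(ps, mst_cost (map real_of_int ` set ps)) | ps. ps \<in> mst_instances p}"

text \<open>Coordinates of \<open>O(log N)\<close> bits are allowed, with any constant \<open>K\<close> in the \<open>O\<close>.\<close>

definition mst_in_constant_rounds :: "real \<Rightarrow> bool" where
  "mst_in_constant_rounds \<alpha> \<longleftrightarrow> (\<forall>K::nat.
     constant_rounds \<alpha> {(N, b). N \<ge> 2 \<and> b \<ge> 1 \<and> real b \<le> real K * log 2 (real N)}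
       mst_size encode_point mst_task)"

text \<open>Simple graphs on the vertices \<open>{..<n}\<close> with at most \<open>K n\<close> edges, given as edge lists.\<close>

definition graph_instances :: "nat \<Rightarrow> nat \<Rightarrow> (nat \<times> nat) list set" where
  "graph_instances K n =
     {es. distinct es \<and> length es \<le> K * n \<and> (\<forall>(u, v)\<in>set es. u < v \<and> v < n)}"

definition encode_edge :: "nat \<Rightarrow> nat \<Rightarrow> nat \<times> nat \<Rightarrow> nat list" where
  "encode_edge n w = (\<lambda>(u, v). [u, v])"

definition connectivity_task :: "nat \<Rightarrow> nat \<Rightarrow> ((nat \<times> nat) list \<times> bool) set" where
  "connectivity_task K n =
     {(es, connected_graph {..<n} {{u, v} | u v. (u, v) \<in> set es}) | es. es \<in> graph_instances K n}"

definition connectivity_in_constant_rounds :: "real \<Rightarrow> bool" where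
  "connectivity_in_constant_rounds \<alpha> \<longleftrightarrow> (\<forall>K::nat.
     constant_rounds \<alpha> {n. n \<ge> 1} (\<lambda>n. n) encode_edge (connectivity_task K))"

end

theory Submission
  imports Defs
begin

text \<open>
  Give every vertex a codeword in \<open>{-1, 1}\<^sup>d\<close> such that for all disjoint \<open>{u, v}\<close> and \<open>{w, x}\<close> some
  coordinate is \<open>1\<close> at \<open>u, v\<close> and \<open>-1\<close> at \<open>w, x\<close>; greedy choice of the coordinates, each of which
  separates at least a sixteenth of the remaining quadruples, shows that \<open>d = 100 log N\<close> suffices.
  Represent an edge, or a vertex regarded as a loop, by the midpoint of the codewords of its ends.
  Two distinct such points are at distance \<open>1\<close> if the edges meet and at distance \<open>2\<close> otherwise, so
  \<open>N\<close> points have a minimum spanning tree of cost \<open>N - 1\<close> exactly if the graph is connected.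
  The code does not depend on the graph, and the point of an edge is kept on the machine that
  holds the edge, so the reduction costs one round without communication.
\<close>

subsection \<open>Spanning trees\<close>

lemma connected_graph_mono:
  assumes "connected_graph V E" "E \<subseteq> F"
  shows "connected_graph V F"
proof -
  have "{(x, y). {x, y} \<in> E}\<^sup>* \<subseteq> {(x, y). {x, y} \<in> F}\<^sup>*"
    using assms(2) by (intro rtrancl_mono) auto
  then show ?thesis
    using assms(1) unfolding connected_graph_def by blast
qed

lemma rtrancl_edges_sym: "(x, y) \<in> {(x, y). {x, y} \<in> E}\<^sup>* \<Longrightarrow> (y, x) \<in> {(x, y). {x, y} \<in> E}\<^sup>*"
  by (rule symD[OF sym_rtrancl]) (auto simp: sym_def insert_commute)

lemma rtrancl_leaves_set:
  assumes "(x, y) \<in> r\<^sup>*" "x \<in> S" "y \<notin> S"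
  shows "\<exists>a b. (a, b) \<in> r \<and> a \<in> S \<and> b \<notin> S"
  using assms by (induction rule: rtrancl_induct) blast+

text \<open>A tree is grown one vertex at a time. A path of \<open>E\<close> from the reached set
  \<open>S\<close> to a vertex outside must leave \<open>S\<close> along some edge; adding this edge
  and its outer end raises both counts by one. The invariant \<open>\<Union>T \<subseteq> S\<close>
  guarantees that the edge is new.\<close>

lemma connected_graph_grow:
  assumes conn: "connected_graph V E" and fin: "finite V" and E: "E \<subseteq> complete_edges V"
    and "k < card V"
  shows "\<exists>S T. S \<subseteq> V \<and> card S = Suc k \<and> T \<subseteq> E \<and> finite T \<and> card T = k \<and> \<Union>T \<subseteq> S \<and> connected_graph S T"
  using \<open>k < card V\<close>
proof (induction k)
  case 0
  then obtain r where "r \<in> V" by fastforce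
  then show ?case
    by (intro exI[of _ "{r}"] exI[of _ "{}"]) (auto simp: connected_graph_def)
next
  case (Suc k)
  then obtain S T where ST: "S \<subseteq> V" "card S = Suc k" "T \<subseteq> E" "finite T" "card T = k" "\<Union>T \<subseteq> S"
    and conn_T: "connected_graph S T" by auto
  have finS: "finite S" using ST(1) fin finite_subset by blast
  obtain s where s: "s \<in> S" using ST(2) by fastforce
  obtain v where v: "v \<in> V" "v \<notin> S" using ST Suc.prems by (metis less_irrefl subsetI subset_antisym)
  have "(s, v) \<in> {(x, y). {x, y} \<in> E}\<^sup>*"
    using conn s v ST(1) by (auto simp: connected_graph_def)
  then obtain x y where xy: "{x, y} \<in> E" "x \<in> S" "y \<notin> S"
    using rtrancl_leaves_set[OF _ s v(2)] by blast
  have y: "y \<in> V" using xy(1) E by (auto simp: complete_edges_def doubleton_eq_iff)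
  let ?T = "insert {x, y} T" and ?r = "{(a, b). {a, b} \<in> insert {x, y} T}"
  have new: "{x, y} \<notin> T" using ST(6) xy(3) by blast
  have S: "(a, b) \<in> ?r\<^sup>*" if "a \<in> S" "b \<in> S" for a b
    using connected_graph_mono[OF conn_T, of ?T] that by (auto simp: connected_graph_def)
  have to: "(x, y) \<in> ?r" "(y, x) \<in> ?r" by (auto simp: insert_commute)
  have "connected_graph (insert y S) ?T"
    unfolding connected_graph_def
  proof (intro ballI)
    fix a b assume ab: "a \<in> insert y S" "b \<in> insert y S"
    have "(a, x) \<in> ?r\<^sup>*" using ab(1) S xy(2) to by blast
    moreover have "(x, b) \<in> ?r\<^sup>*" using ab(2) S xy(2) to by blast
    ultimately show "(a, b) \<in> ?r\<^sup>*" by (rule rtrancl_trans)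
  qed
  then show ?case
    using ST xy y finS new by (intro exI[of _ "insert y S"] exI[of _ ?T]) auto
qed

lemma finite_complete_edges: "finite V \<Longrightarrow> finite (complete_edges V)"
  by (rule finite_subset[of _ "Pow V"]) (auto simp: complete_edges_def)

lemma connected_graph_subgraph:
  assumes "connected_graph V E" "finite V" "V \<noteq> {}" "E \<subseteq> complete_edges V"
  shows "\<exists>T\<subseteq>E. card T = card V - 1 \<and> connected_graph V T"
proof -
  have "card V - 1 < card V" using assms(2,3) by (simp add: card_gt_0_iff)
  from connected_graph_grow[OF assms(1,2,4) this] obtain S T
    where "S \<subseteq> V" "card S = Suc (card V - 1)" "T \<subseteq> E" "card T = card V - 1" "connected_graph S T"
    by blast
  moreover from this have "S = V"
    using assms(2) \<open>card V - 1 < card V\<close> by (intro card_subset_eq) auto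
  ultimately show ?thesis by blast
qed

lemma connected_graph_card_le:
  assumes "connected_graph V E" "finite V" "E \<subseteq> complete_edges V"
  shows "card V - 1 \<le> card E"
proof (cases "V = {}")
  case False
  then show ?thesis
    using connected_graph_subgraph[OF assms(1,2) False assms(3)]
      card_mono[OF finite_subset[OF assms(3) finite_complete_edges[OF assms(2)]]] by metis
qed simp

text \<open>The remaining edges of the cycle still join the two ends of the deleted closing edge, so
  every use of that edge in a path can be replaced by the way round.\<close>

lemma connected_graph_remove_cycle_edge:
  assumes conn: "connected_graph V E" and "has_cycle E"
  shows "\<exists>e\<in>E. connected_graph V (E - {e})"
proof -
  obtain c where c: "length c \<ge> 3" "distinct c"
    and cE: "\<And>i. i < length c \<Longrightarrow> {c ! i, c ! (Suc i mod length c)} \<in> E"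
    using assms(2) unfolding has_cycle_def by blast
  define k where "k = length c - 1"
  have k: "length c = Suc k" "k \<ge> 2" using c(1) by (auto simp: k_def)
  let ?e = "{c ! k, c ! 0}" and ?r = "{(x, y). {x, y} \<in> E - {{c ! k, c ! 0}}}"
  have e: "?e \<in> E" using cE[of k] k by simp
  have path: "(c ! 0, c ! i) \<in> ?r\<^sup>*" if "i \<le> k" for i
    using that
  proof (induction i)
    case (Suc i)
    have "{c ! i, c ! Suc i} \<in> E" using cE[of i] Suc.prems k by simp
    \<comment> \<open>This uses that the cycle has at least three distinct vertices: with two, the
      closing edge would be the edge between \<open>c ! 0\<close> and \<open>c ! 1\<close>.\<close>
    moreover have "{c ! i, c ! Suc i} \<noteq> ?e"
      using Suc.prems k c(2) by (auto simp: doubleton_eq_iff nth_eq_iff_index_eq)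
    ultimately have "(c ! i, c ! Suc i) \<in> ?r" by simp
    moreover have "(c ! 0, c ! i) \<in> ?r\<^sup>*" using Suc by simp
    ultimately show ?case by (rule rtrancl_into_rtrancl[rotated])
  qed simp
  have ends: "(c ! 0, c ! k) \<in> ?r\<^sup>*" using path[of k] by simp
  have ends': "(c ! k, c ! 0) \<in> ?r\<^sup>*" by (rule rtrancl_edges_sym[OF ends])
  have "{(x, y). {x, y} \<in> E} \<subseteq> ?r\<^sup>*"
  proof
    fix p assume "p \<in> {(x, y). {x, y} \<in> E}"
    then obtain x y where p: "p = (x, y)" "{x, y} \<in> E" by blast
    show "p \<in> ?r\<^sup>*"
    proof (cases "{x, y} = ?e")
      case True
      then have "p = (c ! k, c ! 0) \<or> p = (c ! 0, c ! k)"
        unfolding p(1) doubleton_eq_iff by blast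
      then show ?thesis using ends ends' by metis
    next
      case False
      then have "p \<in> ?r" using p by blast
      then show ?thesis by (rule r_into_rtrancl)
    qed
  qed
  then have "{(x, y). {x, y} \<in> E}\<^sup>* \<subseteq> ?r\<^sup>*"
    by (rule rtrancl_subset_rtrancl)
  then have "connected_graph V (E - {?e})"
    using conn unfolding connected_graph_def by blast
  with e show ?thesis by blast
qed

text \<open>A connected subgraph with \<open>card V - 1\<close> edges has no cycle: deleting an edge
  of a cycle would leave a connected graph with fewer edges than
  \<open>connected_graph_card_le\<close> permits.\<close>

lemma ex_spanning_tree:
  assumes "connected_graph V E" "finite V" "V \<noteq> {}" "E \<subseteq> complete_edges V"
  shows "\<exists>T\<subseteq>E. card T = card V - 1 \<and> spanning_tree V T"
proof -
  obtain T where T: "T \<subseteq> E" "card T = card V - 1" "connected_graph V T"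
    using connected_graph_subgraph[OF assms] by blast
  have TV: "T \<subseteq> complete_edges V" using T(1) assms(4) by blast
  have finT: "finite T" using TV finite_complete_edges[OF assms(2)] finite_subset by blast
  have "\<not> has_cycle T"
  proof
    assume "has_cycle T"
    then obtain e where e: "e \<in> T" "connected_graph V (T - {e})"
      using connected_graph_remove_cycle_edge[OF T(3)] by blast
    have "card V - 1 \<le> card (T - {e})"
      using connected_graph_card_le[OF e(2) assms(2)] TV by blast
    also have "\<dots> < card T" using e(1) finT by (rule card_Diff1_less[rotated])
    finally show False using T(2) by simp
  qed
  then show ?thesis using T TV unfolding spanning_tree_def by blast
qed

lemma connected_complete_edges: "connected_graph V (complete_edges V)"
  unfolding connected_graph_def
proof (intro ballI)
  fix u v assume "u \<in> V" "v \<in> V"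
  then show "(u, v) \<in> {(x, y). {x, y} \<in> complete_edges V}\<^sup>*"
    by (cases "u = v") (auto simp: complete_edges_def)
qed

section \<open>Minimum spanning trees when all distances are at least 1\<close>

lemma edge_length_doubleton:
  assumes "linf_dist x y = linf_dist y x"
  shows "edge_length {x, y} = linf_dist x y"
  unfolding edge_length_def by (rule the_equality) (use assms in \<open>auto simp: doubleton_eq_iff\<close>)

text \<open>Every spanning tree has at least \<open>card P - 1\<close> edges, each of length at
  least 1. So this cost is a lower bound, and it is attained exactly if some spanning tree uses unit
  edges only.\<close>

lemma mst_cost_eq_card_iff:
  assumes fin: "finite P" and "P \<noteq> {}"
    and sym: "\<And>x y. x \<in> P \<Longrightarrow> y \<in> P \<Longrightarrow> linf_dist x y = linf_dist y x"
    and ge1: "\<And>x y. x \<in> P \<Longrightarrow> y \<in> P \<Longrightarrow> x \<noteq> y \<Longrightarrow> 1 \<le> linf_dist x y"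
  shows "mst_cost P = real (card P - 1) \<longleftrightarrow>
    connected_graph P {{x, y} | x y. x \<in> P \<and> y \<in> P \<and> x \<noteq> y \<and> linf_dist x y = 1}"
    (is "_ \<longleftrightarrow> connected_graph P ?E")
proof -
  have E: "?E \<subseteq> complete_edges P" by (auto simp: complete_edges_def)
  have len_ge: "1 \<le> edge_length e" if "e \<in> complete_edges P" for e
    using that ge1 by (auto simp: complete_edges_def edge_length_doubleton[OF sym])
  have len_eq: "e \<in> ?E \<longleftrightarrow> edge_length e = 1" if e: "e \<in> complete_edges P" for e
  proof
    assume "e \<in> ?E"
    then show "edge_length e = 1" by (auto simp: edge_length_doubleton[OF sym])
  next
    assume "edge_length e = 1"
    with e show "e \<in> ?E"
      unfolding complete_edges_def
      by (smt (verit) edge_length_doubleton mem_Collect_eq sym)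
  qed
  have fin_T: "finite T" if "spanning_tree P T" for T
    using that finite_complete_edges[OF fin] finite_subset unfolding spanning_tree_def by blast
  have total_ge: "real (card T) \<le> total_length T" if "spanning_tree P T" for T
  proof -
    have "(\<Sum>e\<in>T. 1) \<le> (\<Sum>e\<in>T. edge_length e)"
      using that len_ge by (intro sum_mono) (auto simp: spanning_tree_def)
    then show ?thesis by (simp add: total_length_def)
  qed
  have card_ge: "card P - 1 \<le> card T" if "spanning_tree P T" for T
    using that connected_graph_card_le[OF _ fin] by (auto simp: spanning_tree_def)
  define T0 where "T0 = arg_min total_length (spanning_tree P)"
  \<comment> \<open>\<open>mst_cost\<close> relies on the choice operator \<open>arg_min\<close>,
    which yields a minimizer only if one exists. It does, as the spanning trees of a finite nonempty
    set form a finite nonempty family.\<close>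
  have "finite (Collect (spanning_tree P))"
    by (rule finite_subset[of _ "Pow (complete_edges P)"])
      (auto simp: spanning_tree_def finite_complete_edges fin)
  moreover have "Collect (spanning_tree P) \<noteq> {}"
    using ex_spanning_tree[OF connected_complete_edges fin \<open>P \<noteq> {}\<close> order_refl] by blast
  ultimately have "\<exists>T. is_arg_min total_length (\<lambda>T. T \<in> Collect (spanning_tree P)) T"
    by (rule ex_is_arg_min_if_finite)
  then have "is_arg_min total_length (spanning_tree P) T0"
    unfolding T0_def arg_min_def by (auto intro: someI_ex)
  then have T0: "spanning_tree P T0" and min: "\<And>T. spanning_tree P T \<Longrightarrow> total_length T0 \<le> total_length T"
    by (auto simp: is_arg_min_linorder)
  have cost: "mst_cost P = total_length T0" by (simp add: mst_cost_def T0_def)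
  have lower: "real (card P - 1) \<le> total_length T0"
    using total_ge[OF T0] card_ge[OF T0] by linarith
  show ?thesis
  proof
    assume "mst_cost P = real (card P - 1)"
    \<comment> \<open>The sum of the excesses over 1 is the cost minus the number of edges. Its
      terms are nonnegative, so all of them vanish and \<open>T0\<close> consists of unit
      edges.\<close>
    then have "(\<Sum>e\<in>T0. edge_length e - 1) \<le> 0"
      using card_ge[OF T0] by (simp add: cost total_length_def sum_subtractf)
    moreover have nonneg: "0 \<le> edge_length e - 1" if "e \<in> T0" for e
      using that T0 len_ge[of e] by (auto simp: spanning_tree_def)
    moreover have "0 \<le> (\<Sum>e\<in>T0. edge_length e - 1)"
      using nonneg by (intro sum_nonneg) auto
    ultimately have "\<forall>e\<in>T0. edge_length e - 1 = 0"
      using sum_nonneg_eq_0_iff[OF fin_T[OF T0], of "\<lambda>e. edge_length e - 1"] by force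
    then have "T0 \<subseteq> ?E"
      using T0 len_eq by (auto simp: spanning_tree_def subset_iff)
    then show "connected_graph P ?E"
      using T0 connected_graph_mono unfolding spanning_tree_def by blast
  next
    assume "connected_graph P ?E"
    then obtain T where T: "T \<subseteq> ?E" "card T = card P - 1" "spanning_tree P T"
      using ex_spanning_tree[OF _ fin \<open>P \<noteq> {}\<close> E] by blast
    have "total_length T = (\<Sum>e\<in>T. 1)"
      unfolding total_length_def
    proof (rule sum.cong)
      fix e assume "e \<in> T"
      then show "edge_length e = 1" using T(1) E len_eq[of e] by blast
    qed simp
    then have "total_length T = real (card P - 1)" using T(2) by simp
    then show "mst_cost P = real (card P - 1)"
      using lower min[OF T(3)] cost by linarith
  qed
qed


subsection \<open>Separating families\<close>

definition separates :: "'a set \<Rightarrow> 'a \<times> 'a \<times> 'a \<times> 'a \<Rightarrow> bool" where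
  "separates S = (\<lambda>(u, v, w, x). u \<in> S \<and> v \<in> S \<and> w \<notin> S \<and> x \<notin> S)"

text \<open>In probabilistic terms, a uniformly random subset of \<open>V\<close> separates the
  quadruple with probability at least 1/16, because at most four memberships are prescribed.\<close>

lemma card_separating_sets:
  assumes "finite V" "{u, v, w, x} \<subseteq> V" "{u, v} \<inter> {w, x} = {}"
  shows "2 ^ card V \<le> 16 * card {S \<in> Pow V. separates S (u, v, w, x)}"
proof -
  let ?B = "{S \<in> Pow V. separates S (u, v, w, x)}"
  \<comment> \<open>The first component of \<open>f\<close> forces the prescribed memberships and
    the second records the original ones, so \<open>S\<close> can be recovered.\<close>
  define f where "f S = (S \<union> {u, v} - {w, x}, S \<inter> {u, v, w, x})" for S
  have "inj_on f (Pow V)" by (auto simp: inj_on_def f_def)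
  moreover have "f ` Pow V \<subseteq> ?B \<times> Pow {u, v, w, x}"
    using assms by (auto simp: f_def separates_def)
  ultimately have "card (Pow V) \<le> card (?B \<times> Pow {u, v, w, x})"
    using assms(1) by (intro card_inj_on_le) auto
  also have "\<dots> = card ?B * 2 ^ card {u, v, w, x}"
    by (simp add: card_cartesian_product card_Pow)
  also have "\<dots> \<le> card ?B * 2 ^ 4"
    by (intro mult_left_mono power_increasing) (auto simp: card_insert_if)
  finally show ?thesis using assms(1) by (simp add: card_Pow)
qed

text \<open>Averaging: counting the pairs of a set and a quadruple separated by it in both orders,
  the average subset of \<open>V\<close> separates at least a sixteenth of \<open>Q\<close>.\<close>

lemma ex_separating_many:
  assumes "finite V" "finite Q"
    and Q: "\<And>u v w x. (u, v, w, x) \<in> Q \<Longrightarrow> {u, v, w, x} \<subseteq> V \<and> {u, v} \<inter> {w, x} = {}"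
  shows "\<exists>S. card Q \<le> 16 * card {q \<in> Q. separates S q}"
proof (rule ccontr)
  assume "\<not> ?thesis"
  then have less: "16 * card {q \<in> Q. separates S q} < card Q" for S
    by (simp add: not_le)
  have "2 ^ card V * card Q = (\<Sum>q\<in>Q. 2 ^ card V)" by simp
  also have "\<dots> \<le> (\<Sum>q\<in>Q. 16 * card {S \<in> Pow V. separates S q})"
  proof (rule sum_mono)
    fix q assume "q \<in> Q"
    obtain u v w x where q: "q = (u, v, w, x)" by (cases q)
    show "2 ^ card V \<le> 16 * card {S \<in> Pow V. separates S q}"
      unfolding q using Q[of u v w x] \<open>q \<in> Q\<close> q
      by (intro card_separating_sets[OF assms(1)]) auto
  qed
  also have "\<dots> = (\<Sum>S\<in>Pow V. 16 * card {q \<in> Q. separates S q})"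
    using sum.swap_restrict[of Q "Pow V" "\<lambda>_ _. 16::nat" "\<lambda>q S. separates S q"] assms
    by (simp add: mult.commute)
  also have "\<dots> < (\<Sum>S\<in>Pow V. card Q)"
    using less assms(1) by (intro sum_strict_mono) auto
  finally show False using assms(1) by (simp add: card_Pow)
qed

text \<open>Each further set is chosen for the quadruples that are still unseparated and leaves at
  most 15/16 of them. The bound is multiplied out so that it lives in the natural numbers.\<close>

lemma ex_separating_family:
  assumes "finite V" "finite Q"
    and Q: "\<And>u v w x. (u, v, w, x) \<in> Q \<Longrightarrow> {u, v, w, x} \<subseteq> V \<and> {u, v} \<inter> {w, x} = {}"
  shows "\<exists>F. 16 ^ d * card {q \<in> Q. \<forall>i<d. \<not> separates (F i) q} \<le> 15 ^ d * card Q"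
proof (induction d)
  case (Suc d)
  then obtain F where F: "16 ^ d * card {q \<in> Q. \<forall>i<d. \<not> separates (F i) q} \<le> 15 ^ d * card Q" by blast
  let ?R = "{q \<in> Q. \<forall>i<d. \<not> separates (F i) q}"
  have "\<exists>S. card ?R \<le> 16 * card {q \<in> ?R. separates S q}"
  proof (rule ex_separating_many[OF assms(1)])
    show "finite ?R" using assms(2) by simp
  next
    fix u v w x assume "(u, v, w, x) \<in> ?R"
    then show "{u, v, w, x} \<subseteq> V \<and> {u, v} \<inter> {w, x} = {}" using Q[of u v w x] by simp
  qed
  then obtain S where S: "card ?R \<le> 16 * card {q \<in> ?R. separates S q}" by blast
  let ?F = "F(d := S)"
  let ?R' = "{q \<in> Q. \<forall>i<Suc d. \<not> separates (?F i) q}"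
  have "?R' = ?R - {q \<in> ?R. separates S q}"
  proof (rule set_eqI)
    fix q
    have "(\<forall>i<Suc d. \<not> separates (?F i) q) \<longleftrightarrow> (\<forall>i<d. \<not> separates (F i) q) \<and> \<not> separates S q"
      unfolding All_less_Suc by auto
    then show "q \<in> ?R' \<longleftrightarrow> q \<in> ?R - {q \<in> ?R. separates S q}" by blast
  qed
  moreover have "card (?R - {q \<in> ?R. separates S q}) = card ?R - card {q \<in> ?R. separates S q}"
    using assms(2) by (intro card_Diff_subset) auto
  ultimately have "card ?R' = card ?R - card {q \<in> ?R. separates S q}" by (simp only:)
  then have "16 * card ?R' \<le> 15 * card ?R" using S by linarith
  then have "16 ^ d * (16 * card ?R') \<le> 16 ^ d * (15 * card ?R)"
    by (rule mult_le_mono2)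
  also have "\<dots> = 15 * (16 ^ d * card ?R)" by (rule mult.left_commute)
  also have "\<dots> \<le> 15 * (15 ^ d * card Q)" using F by (rule mult_le_mono2)
  finally have "16 ^ Suc d * card ?R' \<le> 15 ^ Suc d * card Q"
    by (simp only: power_Suc2 mult.assoc mult.left_commute[of 15])
  then show ?case by blast
qed simp

text \<open>The cases \<open>u = v\<close> and \<open>w = x\<close> are included on purpose: they
  cover loops and also yield coordinates that distinguish two single vertices.\<close>

definition separating_family :: "nat \<Rightarrow> nat \<Rightarrow> (nat \<Rightarrow> nat set) \<Rightarrow> bool" where
  "separating_family N d F \<longleftrightarrow> (\<forall>u<N. \<forall>v<N. \<forall>w<N. \<forall>x<N. {u, v} \<inter> {w, x} = {} \<longrightarrow>
     (\<exists>i<d. separates (F i) (u, v, w, x)))"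

text \<open>With \<open>d = mst_dim N\<close>, \<open>(16/15) ^ d\<close> is at least
  \<open>32 powr log 2 N = N ^ 5\<close>, which exceeds the bound \<open>N ^ 4\<close> on the number
  of quadruples.\<close>

lemma separation_rate:
  assumes "N \<ge> 2"
  shows "15 ^ mst_dim N * N ^ 4 < (16::nat) ^ mst_dim N"
proof -
  define d where "d = mst_dim N"
  have "real N ^ 4 < real N ^ 5"
    using assms by (intro power_strict_increasing) auto
  also have "real N ^ 5 = (2 powr log 2 (real N)) powr 5"
    using assms by simp
  also have "\<dots> = 32 powr log 2 (real N)"
    using powr_powr_swap[of 2 "log 2 (real N)" 5] by simp
  also have "\<dots> \<le> ((16 / 15) ^ 100) powr log 2 (real N)"
  proof (rule powr_mono2)
    \<comment> \<open>Here the factor 100 of the dimension enters: \<open>(16/15) ^ 100\<close> is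
      about 635.\<close>
    show "(32::real) \<le> (16 / 15) ^ 100" by (simp add: power_divide)
  qed (use assms in auto)
  also have "\<dots> = ((16 / 15) powr 100) powr log 2 (real N)"
    using powr_realpow[of "16 / 15" 100] by (simp only: of_nat_numeral)
  also have "\<dots> = (16 / 15) powr (100 * log 2 (real N))"
    by (rule powr_powr)
  also have "\<dots> \<le> (16 / 15) powr real d"
    unfolding d_def mst_dim_def by (intro powr_mono) linarith+
  also have "\<dots> = (16 / 15) ^ d" by (simp add: powr_realpow)
  finally have "real N ^ 4 * 15 ^ d < 16 ^ d"
    by (simp add: power_divide field_simps)
  then have "real (15 ^ d * N ^ 4) < real (16 ^ d)" by (simp add: mult.commute)
  then show ?thesis unfolding d_def[symmetric] by (simp only: of_nat_less_iff)
qed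

lemma ex_separating_family_mst_dim:
  assumes "N \<ge> 2"
  shows "\<exists>F. separating_family N (mst_dim N) F"
proof -
  define Q where "Q = {(u, v, w, x). {u, v, w, x} \<subseteq> {..<N} \<and> {u, v} \<inter> {w, x} = {}}"
  have sub: "Q \<subseteq> {..<N} \<times> {..<N} \<times> {..<N} \<times> {..<N}" by (auto simp: Q_def)
  have fin: "finite Q" by (rule finite_subset[OF sub]) auto
  have "card Q \<le> N ^ 4"
    using card_mono[OF _ sub] by (simp add: card_cartesian_product power4_eq_xxxx mult.assoc)
  obtain F where F: "16 ^ mst_dim N * card {q \<in> Q. \<forall>i<mst_dim N. \<not> separates (F i) q}
      \<le> 15 ^ mst_dim N * card Q"
    using ex_separating_family[of "{..<N}" Q "mst_dim N"] fin by (auto simp: Q_def)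
  also have "\<dots> \<le> 15 ^ mst_dim N * N ^ 4" using \<open>card Q \<le> N ^ 4\<close> by simp
  also have "\<dots> < 16 ^ mst_dim N" by (rule separation_rate[OF assms])
  \<comment> \<open>\<open>16 ^ d\<close> times the number of unseparated quadruples is below
    \<open>16 ^ d\<close>, so this number is 0.\<close>
  finally have "card {q \<in> Q. \<forall>i<mst_dim N. \<not> separates (F i) q} = 0" by simp
  then have "{q \<in> Q. \<forall>i<mst_dim N. \<not> separates (F i) q} = {}" using fin by simp
  then have "separating_family N (mst_dim N) F"
    unfolding separating_family_def Q_def by blast
  then show ?thesis by blast
qed


subsection \<open>Points from pairs of codewords\<close>

lemma linf_dist_commute: "length x = length y \<Longrightarrow> linf_dist x y = linf_dist y x"
  unfolding linf_dist_def by (simp add: abs_minus_commute)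

lemma abs_diff_le_linf_dist: "i < length x \<Longrightarrow> \<bar>x ! i - y ! i\<bar> \<le> linf_dist x y"
  unfolding linf_dist_def by (rule Max_ge) auto

lemma linf_dist_le:
  assumes "x \<noteq> []" "\<And>i. i < length x \<Longrightarrow> \<bar>x ! i - y ! i\<bar> \<le> c"
  shows "linf_dist x y \<le> c"
  unfolding linf_dist_def using assms by (subst Max_le_iff) auto

definition meets :: "'a \<times> 'a \<Rightarrow> 'a \<times> 'a \<Rightarrow> bool" where
  "meets e f \<longleftrightarrow> {fst e, snd e} \<inter> {fst f, snd f} \<noteq> {}"

text \<open>
  The midpoint of the codewords of \<open>u\<close> and \<open>v\<close>, where the codeword of \<open>u\<close> has the coordinates
  \<open>1\<close> or \<open>-1\<close> according to \<open>u \<in> F i\<close>.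
\<close>

definition pair_point :: "nat \<Rightarrow> (nat \<Rightarrow> nat set) \<Rightarrow> nat \<times> nat \<Rightarrow> int list" where
  "pair_point d F = (\<lambda>(u, v). map (\<lambda>i. of_bool (u \<in> F i) + of_bool (v \<in> F i) - 1) [0..<d])"

abbreviation real_point :: "nat \<Rightarrow> (nat \<Rightarrow> nat set) \<Rightarrow> nat \<times> nat \<Rightarrow> real list" where
  "real_point d F e \<equiv> map real_of_int (pair_point d F e)"

lemma length_pair_point [simp]: "length (pair_point d F e) = d"
  by (simp add: pair_point_def split: prod.split)

lemma nth_pair_point:
  "i < d \<Longrightarrow> pair_point d F (u, v) ! i = of_bool (u \<in> F i) + of_bool (v \<in> F i) - 1"
  by (simp add: pair_point_def)

lemma set_pair_point: "set (pair_point d F e) \<subseteq> {-2..<2}"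
  by (auto simp: pair_point_def of_bool_def split: prod.split)

lemma pair_point_swap: "pair_point d F (u, v) = pair_point d F (v, u)"
  by (simp add: pair_point_def add.commute)

lemma separating_familyD:
  assumes "separating_family N d F" "u < N" "v < N" "w < N" "x < N" "{u, v} \<inter> {w, x} = {}"
  obtains i where "i < d" "u \<in> F i" "v \<in> F i" "w \<notin> F i" "x \<notin> F i"
proof -
  have "\<exists>i<d. separates (F i) (u, v, w, x)"
    using assms unfolding separating_family_def by blast
  then show ?thesis using that by (auto simp: separates_def)
qed

text \<open>At a separating coordinate one midpoint is 1 and the other is -1.\<close>

lemma linf_dist_disjoint_pairs:
  assumes F: "separating_family N d F" and lt: "u < N" "v < N" "w < N" "x < N"
    and "\<not> meets (u, v) (w, x)"
  shows "2 \<le> linf_dist (real_point d F (u, v)) (real_point d F (w, x))"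
proof -
  have "{u, v} \<inter> {w, x} = {}" using assms(6) by (simp add: meets_def)
  from separating_familyD[OF F lt this] obtain i
    where i: "i < d" "u \<in> F i" "v \<in> F i" "w \<notin> F i" "x \<notin> F i" .
  then have "2 \<le> \<bar>real_point d F (u, v) ! i - real_point d F (w, x) ! i\<bar>"
    by (simp add: nth_pair_point)
  also have "\<dots> \<le> linf_dist (real_point d F (u, v)) (real_point d F (w, x))"
    using i(1) by (intro abs_diff_le_linf_dist) simp
  finally show ?thesis .
qed

text \<open>The codeword of the common vertex cancels, leaving half the difference of the codewords
  of \<open>v\<close> and \<open>w\<close>, whose coordinates are -1, 0 or 1. The degenerate
  quadruple \<open>(v, v, w, w)\<close> provides a coordinate where it is not 0.\<close>

lemma linf_dist_common_vertex:
  assumes F: "separating_family N d F" and lt: "v < N" "w < N" and "v \<noteq> w"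
  shows "linf_dist (real_point d F (u, v)) (real_point d F (u, w)) = 1"
proof (rule antisym)
  have "{v, v} \<inter> {w, w} = {}" using assms(4) by simp
  from separating_familyD[OF F lt(1) lt(1) lt(2) lt(2) this] obtain i
    where i: "i < d" "v \<in> F i" "w \<notin> F i" by blast
  then have "1 \<le> \<bar>real_point d F (u, v) ! i - real_point d F (u, w) ! i\<bar>"
    by (simp add: nth_pair_point)
  also have "\<dots> \<le> linf_dist (real_point d F (u, v)) (real_point d F (u, w))"
    using i(1) by (intro abs_diff_le_linf_dist) simp
  finally show "1 \<le> linf_dist (real_point d F (u, v)) (real_point d F (u, w))" .
  show "linf_dist (real_point d F (u, v)) (real_point d F (u, w)) \<le> 1"
  proof (rule linf_dist_le)
    show "real_point d F (u, v) \<noteq> []"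
      using i(1) by (metis length_map length_pair_point list.size(3) not_less_zero)
  qed (simp add: nth_pair_point of_bool_def)
qed

lemma linf_dist_meeting_pairs:
  assumes F: "separating_family N d F" and lt: "u < N" "v < N" "w < N" "x < N"
    and "{u, v} \<noteq> {w, x}" "meets (u, v) (w, x)"
  shows "linf_dist (real_point d F (u, v)) (real_point d F (w, x)) = 1"
proof -
  consider "u = w" "v \<noteq> x" | "u = x" "v \<noteq> w" | "v = w" "u \<noteq> x" | "v = x" "u \<noteq> w"
    using assms(6,7) by (auto simp: meets_def)
  then show ?thesis
  proof cases
    case 1
    then show ?thesis using linf_dist_common_vertex[OF F lt(2,4)] by simp
  next
    case 2
    then show ?thesis
      using linf_dist_common_vertex[OF F lt(2,3)] by (simp add: pair_point_swap[of _ _ w x])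
  next
    case 3
    then show ?thesis
      using linf_dist_common_vertex[OF F lt(1,4)] by (simp add: 3 pair_point_swap[of _ _ u w])
  next
    case 4
    then show ?thesis
      using linf_dist_common_vertex[OF F lt(1,3)]
      by (simp add: 4 pair_point_swap[of _ _ w x] pair_point_swap[of _ _ u x])
  qed
qed

text \<open>The order \<open>u \<le> v\<close> makes distinct pairs have distinct sets of ends;
  \<open>(u, v)\<close> and \<open>(v, u)\<close> would give the same point.\<close>

lemma linf_dist_pairs:
  assumes F: "separating_family N d F" and W: "W \<subseteq> {(u, v). u \<le> v \<and> v < N}"
    and "e \<in> W" "f \<in> W" "e \<noteq> f"
  shows "1 \<le> linf_dist (real_point d F e) (real_point d F f)"
    and "linf_dist (real_point d F e) (real_point d F f) = 1 \<longleftrightarrow> meets e f"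
proof -
  obtain u v w x where ef: "e = (u, v)" "f = (w, x)" by fastforce
  have le: "u \<le> v" "v < N" "w \<le> x" "x < N" using assms(3,4) W ef by auto
  then have lt: "u < N" "v < N" "w < N" "x < N" by auto
  have ne: "{u, v} \<noteq> {w, x}" using le assms(5) ef by (auto simp: doubleton_eq_iff)
  have m: "meets e f \<Longrightarrow> linf_dist (real_point d F e) (real_point d F f) = 1"
    unfolding ef by (rule linf_dist_meeting_pairs[OF F lt ne])
  have nm: "\<not> meets e f \<Longrightarrow> 2 \<le> linf_dist (real_point d F e) (real_point d F f)"
    unfolding ef by (rule linf_dist_disjoint_pairs[OF F lt])
  show "1 \<le> linf_dist (real_point d F e) (real_point d F f)"
    and "linf_dist (real_point d F e) (real_point d F f) = 1 \<longleftrightarrow> meets e f"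
    using m nm by fastforce+
qed

lemma inj_on_real_point:
  assumes "separating_family N d F" "W \<subseteq> {(u, v). u \<le> v \<and> v < N}" "d > 0"
  shows "inj_on (real_point d F) W"
proof (rule inj_onI, rule ccontr)
  fix e f assume *: "e \<in> W" "f \<in> W" "real_point d F e = real_point d F f" "e \<noteq> f"
  have ne: "real_point d F f \<noteq> []"
    using assms(3) by (metis length_map length_pair_point list.size(3) less_irrefl)
  have "linf_dist (real_point d F f) (real_point d F f) \<le> 0"
    by (rule linf_dist_le[OF ne]) simp
  with linf_dist_pairs(1)[OF assms(1,2) *(1,2,4)] *(3) show False by simp
qed

text \<open>Geometry is replaced by incidence: the injective point map turns chains of meeting pairs
  into paths of unit edges and back. \<open>meets\<close> is reflexive while unit edges join
  distinct points, which makes no difference to the reflexive transitive closures.\<close>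

lemma mst_cost_pairs:
  assumes F: "separating_family N d F" and W: "W \<subseteq> {(u, v). u \<le> v \<and> v < N}"
    and "d > 0" "W \<noteq> {}"
  shows "mst_cost (real_point d F ` W) = real (card W - 1) \<longleftrightarrow>
    (\<forall>e\<in>W. \<forall>f\<in>W. (e, f) \<in> {(e, f). e \<in> W \<and> f \<in> W \<and> meets e f}\<^sup>*)"
proof -
  let ?q = "real_point d F" and ?R = "{(e, f). e \<in> W \<and> f \<in> W \<and> meets e f}"
  let ?P = "?q ` W"
  let ?E = "{{x, y} | x y. x \<in> ?P \<and> y \<in> ?P \<and> x \<noteq> y \<and> linf_dist x y = 1}"
  let ?S = "{(x, y). {x, y} \<in> ?E}"
  have "W \<subseteq> {..<N} \<times> {..<N}" using W by auto
  then have finW: "finite W" by (rule finite_subset) simp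
  have inj: "inj_on ?q W" by (rule inj_on_real_point[OF F W \<open>d > 0\<close>])
  have len: "linf_dist x y = linf_dist y x" if "x \<in> ?P" "y \<in> ?P" for x y
    using that by (auto intro!: linf_dist_commute)
  have S: "(?q e, ?q f) \<in> ?S \<longleftrightarrow> e \<noteq> f \<and> meets e f" if "e \<in> W" "f \<in> W" for e f
  proof -
    have "(?q e, ?q f) \<in> ?S \<longleftrightarrow> ?q e \<noteq> ?q f \<and> linf_dist (?q e) (?q f) = 1"
    proof
      assume "(?q e, ?q f) \<in> ?S"
      then show "?q e \<noteq> ?q f \<and> linf_dist (?q e) (?q f) = 1"
        using len[of "?q e" "?q f"] that by (auto simp: doubleton_eq_iff)
    next
      assume "?q e \<noteq> ?q f \<and> linf_dist (?q e) (?q f) = 1"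
      then show "(?q e, ?q f) \<in> ?S" using that by blast
    qed
    also have "?q e \<noteq> ?q f \<longleftrightarrow> e \<noteq> f" using inj that by (meson inj_on_contraD)
    finally show ?thesis using linf_dist_pairs(2)[OF F W that] by blast
  qed
  have fwd: "(?q e, ?q f) \<in> ?S\<^sup>*" if "(e, f) \<in> ?R\<^sup>*" for e f
    using that
  proof (induction rule: rtrancl_induct)
    case (step f g)
    then show ?case using S[of f g] by (cases "f = g") (auto intro: rtrancl_into_rtrancl)
  qed simp
  \<comment> \<open>The end \<open>y\<close> is arbitrary so that induction along the path applies;
    every vertex it visits is traced back to a pair in \<open>W\<close>.\<close>
  have bwd: "\<exists>f\<in>W. y = ?q f \<and> (e, f) \<in> ?R\<^sup>*" if "(?q e, y) \<in> ?S\<^sup>*" "e \<in> W" for e y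
    using that(1)
  proof (induction rule: rtrancl_induct)
    case base
    then show ?case using that(2) by blast
  next
    case (step y z)
    then obtain f where f: "f \<in> W" "y = ?q f" "(e, f) \<in> ?R\<^sup>*" by blast
    have "z \<in> ?P" using step.hyps(2) by (auto simp: doubleton_eq_iff)
    then obtain g where g: "g \<in> W" "z = ?q g" by blast
    have "(f, g) \<in> ?R" using S[OF f(1) g(1)] step.hyps(2) f g by blast
    then have "(e, g) \<in> ?R\<^sup>*" using f(3) by (rule rtrancl_into_rtrancl[rotated])
    then show ?case using g by blast
  qed
  have bwd': "(e, f) \<in> ?R\<^sup>*" if "(?q e, ?q f) \<in> ?S\<^sup>*" "e \<in> W" "f \<in> W" for e f
    using bwd[OF that(1,2)] inj that(3) by (auto dest: inj_onD)
  have "mst_cost ?P = real (card ?P - 1) \<longleftrightarrow> connected_graph ?P ?E"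
  proof (rule mst_cost_eq_card_iff)
    fix x y assume "x \<in> ?P" "y \<in> ?P" "x \<noteq> y"
    then obtain e f where "e \<in> W" "f \<in> W" "e \<noteq> f" "x = ?q e" "y = ?q f" by blast
    then show "1 \<le> linf_dist x y" using linf_dist_pairs(1)[OF F W] by blast
  qed (use finW \<open>W \<noteq> {}\<close> len in auto)
  moreover have "connected_graph ?P ?E \<longleftrightarrow> (\<forall>e\<in>W. \<forall>f\<in>W. (?q e, ?q f) \<in> ?S\<^sup>*)"
    unfolding connected_graph_def by blast
  moreover have "(?q e, ?q f) \<in> ?S\<^sup>* \<longleftrightarrow> (e, f) \<in> ?R\<^sup>*" if "e \<in> W" "f \<in> W" for e f
    using fwd bwd' that by blast
  ultimately show ?thesis by (simp add: card_image[OF inj])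
qed


subsection \<open>From edge lists to pairs\<close>

text \<open>
  The unused places of the edge list are filled by pendant edges from vertex \<open>0\<close> to fresh
  vertices, so that the number of pairs, and hence the expected cost, does not depend on the
  number of edges. The loops \<open>(v, v)\<close> account for isolated vertices.
\<close>

definition slot :: "nat \<Rightarrow> nat \<Rightarrow> (nat \<times> nat) list \<Rightarrow> nat \<Rightarrow> nat \<times> nat" where
  "slot K n es j = (if j < length es then es ! j else if j < K * n then (0, n + j)
     else (j - K * n, j - K * n))"

lemma slot_image:
  assumes "es \<in> graph_instances K n"
  shows "slot K n es ` {..<(K + 1) * n} =
    set es \<union> (\<lambda>j. (0, n + j)) ` {length es..<K * n} \<union> (\<lambda>v. (v, v)) ` {..<n}"
proof -
  have le: "length es \<le> K * n" using assms by (simp add: graph_instances_def)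
  have "{..<(K + 1) * n} = {..<length es} \<union> {length es..<K * n} \<union> (\<lambda>v. K * n + v) ` {..<n}"
  proof (rule set_eqI)
    fix j
    have "j \<in> (\<lambda>v. K * n + v) ` {..<n} \<longleftrightarrow> K * n \<le> j \<and> j < K * n + n"
      by (auto simp: image_iff intro!: bexI[of _ "j - K * n"])
    then show "j \<in> {..<(K + 1) * n} \<longleftrightarrow>
        j \<in> {..<length es} \<union> {length es..<K * n} \<union> (\<lambda>v. K * n + v) ` {..<n}"
      using le by auto
  qed
  moreover have "slot K n es ` {..<length es} = set es"
    by (auto simp: slot_def set_conv_nth image_iff)
  moreover have "slot K n es ` {length es..<K * n} = (\<lambda>j. (0, n + j)) ` {length es..<K * n}"
    by (intro image_cong) (auto simp: slot_def)
  moreover have "slot K n es ` (\<lambda>v. K * n + v) ` {..<n} = (\<lambda>v. (v, v)) ` {..<n}"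
    unfolding image_image using le by (intro image_cong) (auto simp: slot_def)
  ultimately show ?thesis by (simp add: image_Un)
qed

text \<open>The three kinds of slots exclude each other: edges have \<open>u < v < n\<close>,
  pendant edges have second end at least \<open>n\<close>, and loops have equal ends below
  \<open>n\<close>.\<close>

lemma inj_on_slot:
  assumes "es \<in> graph_instances K n"
  shows "inj_on (slot K n es) {..<(K + 1) * n}"
proof -
  have es: "distinct es" "\<And>e. e \<in> set es \<Longrightarrow> fst e < snd e \<and> snd e < n"
    using assms by (auto simp: graph_instances_def)
  have le: "length es \<le> K * n" using assms by (simp add: graph_instances_def)
  show ?thesis
  proof (rule linorder_inj_onI)
    fix i j assume "i < j" "i \<in> {..<(K + 1) * n}" "j \<in> {..<(K + 1) * n}"
    then have ij: "i < j" "j < K * n + n" by auto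
    consider "j < length es" | "i < length es" "length es \<le> j" | "length es \<le> i" by linarith
    then show "slot K n es i \<noteq> slot K n es j"
    proof cases
      case 1
      then show ?thesis using ij(1) es(1) by (simp add: slot_def nth_eq_iff_index_eq)
    next
      case 2
      have "es ! i \<noteq> (0, n + j)" "es ! i \<noteq> (j - K * n, j - K * n)"
        using es(2)[OF nth_mem[OF 2(1)]] by auto
      then show ?thesis using 2 by (simp add: slot_def)
    next
      case 3
      then show ?thesis using ij le by (auto simp: slot_def)
    qed
  qed auto
qed

text \<open>The fresh vertices \<open>n + j\<close> have \<open>j < K * n\<close>, so
  \<open>(K + 1) * n\<close> bounds all vertex names as well as counting the slots. The first end is
  always an original vertex, which lets it represent the slot in
  \<open>connected_slots\<close>.\<close>

lemma slot_subset:
  assumes "es \<in> graph_instances K n"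
  shows "slot K n es ` {..<(K + 1) * n} \<subseteq> {(u, v). u < n \<and> u \<le> v \<and> v < (K + 1) * n}"
proof (cases "n = 0")
  case False
  have "\<And>u v. (u, v) \<in> set es \<Longrightarrow> u < v \<and> v < n"
    using assms by (auto simp: graph_instances_def)
  then show ?thesis
    unfolding slot_image[OF assms] using False by (fastforce simp: add.commute)
qed simp

text \<open>Projecting slots to their first ends turns a chain of meeting slots into a walk in the
  graph. Conversely, a step from \<open>y\<close> to \<open>z\<close> along an edge becomes the loop
  at \<open>y\<close>, the edge, and the loop at \<open>z\<close>; every slot meets the loop at its
  first end.\<close>

lemma connected_slots:
  assumes es: "es \<in> graph_instances K n"
    and W_eq: "W = slot K n es ` {..<(K + 1) * n}"
  shows "(\<forall>e\<in>W. \<forall>f\<in>W. (e, f) \<in> {(e, f). e \<in> W \<and> f \<in> W \<and> meets e f}\<^sup>*) \<longleftrightarrow>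
    connected_graph {..<n} {{u, v} | u v. (u, v) \<in> set es}"
    (is "?L \<longleftrightarrow> connected_graph _ ?E")
proof -
  let ?R = "{(e, f). e \<in> W \<and> f \<in> W \<and> meets e f}" and ?S = "{(x, y). {x, y} \<in> ?E}"
  have W: "W = set es \<union> (\<lambda>j. (0, n + j)) ` {length es..<K * n} \<union> (\<lambda>v. (v, v)) ` {..<n}"
    unfolding W_eq by (rule slot_image[OF es])
  have fst_lt: "fst e < n" if "e \<in> W" for e
    using slot_subset[OF es] that unfolding W_eq by auto
  have es_lt: "u < v" "v < n" if "(u, v) \<in> set es" for u v
    using es that by (auto simp: graph_instances_def)
  have pendant: "e = (0, snd e)" if "e \<in> W" "snd e \<ge> n" for e
    using that es_lt[of "fst e" "snd e"] unfolding W by auto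
  have to_snd: "(fst e, snd e) \<in> ?S\<^sup>*" if "e \<in> W" "snd e < n" for e
    using that unfolding W by auto
  have vertex: "(fst e, z) \<in> ?S\<^sup>*" if "e \<in> W" "z \<in> {fst e, snd e}" "z < n" for e z
  proof (cases "z = fst e")
    case False
    then have "z = snd e" using that(2) by simp
    then show ?thesis using to_snd[OF that(1)] that(3) by simp
  qed simp
  have fst_connected: "(fst e, fst f) \<in> ?S\<^sup>*" if ef: "(e, f) \<in> ?R" for e f
  proof -
    obtain z where z: "z \<in> {fst e, snd e}" "z \<in> {fst f, snd f}"
      using ef by (auto simp: meets_def)
    show ?thesis
    proof (cases "z < n")
      case True
      have 1: "(fst e, z) \<in> ?S\<^sup>*" by (rule vertex[OF _ z(1) True]) (use ef in simp)
      have 2: "(fst f, z) \<in> ?S\<^sup>*" by (rule vertex[OF _ z(2) True]) (use ef in simp)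
      show ?thesis by (rule rtrancl_trans[OF 1 rtrancl_edges_sym[OF 2]])
    next
      \<comment> \<open>A common vertex that is not original is fresh, and only one pendant edge
        contains it, so the two slots coincide.\<close>
      case False
      have W: "e \<in> W" "f \<in> W" using ef by auto
      then have "snd e = z" "snd f = z" using z fst_lt[of e] fst_lt[of f] False by auto
      then have "e = f" using pendant[of e] pendant[of f] W False by auto
      then show ?thesis by simp
    qed
  qed
  have R_to_S: "(fst e, fst f) \<in> ?S\<^sup>*" if "(e, f) \<in> ?R\<^sup>*" for e f
    using that
  proof (induction rule: rtrancl_induct)
    case (step f g)
    show ?case by (rule rtrancl_trans[OF step.IH fst_connected[OF step.hyps(2)]])
  qed simp
  have loop: "(v, v) \<in> W" if "v < n" for v using that unfolding W by auto
  have S_to_R: "((u, u), (v, v)) \<in> ?R\<^sup>*" if "(u, v) \<in> ?S\<^sup>*" for u v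
    using that
  proof (induction rule: rtrancl_induct)
    case (step y z)
    from step.hyps(2) obtain u v where "{y, z} = {u, v}" "(u, v) \<in> set es" by blast
    then obtain e where e: "e \<in> set es" "{y, z} = {fst e, snd e}" by (metis fst_conv snd_conv)
    then have lt: "y < n" "z < n" using es_lt[of "fst e" "snd e"] by (auto simp: doubleton_eq_iff)
    have "e \<in> W" using e(1) unfolding W by blast
    then have R: "((y, y), e) \<in> ?R" "(e, (z, z)) \<in> ?R"
      using loop lt e(2) by (auto simp: meets_def doubleton_eq_iff)
    show ?case by (rule rtrancl_into_rtrancl[OF rtrancl_into_rtrancl[OF step.IH R(1)] R(2)])
  qed simp
  have to_loop: "(e, (fst e, fst e)) \<in> ?R" "((fst e, fst e), e) \<in> ?R" if "e \<in> W" for e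
    using that loop fst_lt by (auto simp: meets_def)
  show ?thesis
  proof
    assume ?L
    show "connected_graph {..<n} ?E"
      unfolding connected_graph_def
    proof (intro ballI)
      fix u v assume "u \<in> {..<n}" "v \<in> {..<n}"
      then have "((u, u), (v, v)) \<in> ?R\<^sup>*" using \<open>?L\<close> loop by blast
      from R_to_S[OF this] show "(u, v) \<in> ?S\<^sup>*" by simp
    qed
  next
    assume conn: "connected_graph {..<n} ?E"
    show ?L
    proof (intro ballI)
      fix e f assume ef: "e \<in> W" "f \<in> W"
      then have R: "((fst e, fst e), (fst f, fst f)) \<in> ?R\<^sup>*"
        using conn fst_lt by (intro S_to_R) (simp add: connected_graph_def)
      show "(e, f) \<in> ?R\<^sup>*"
        by (rule converse_rtrancl_into_rtrancl[OF to_loop(1)[OF ef(1)]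
              rtrancl_into_rtrancl[OF R to_loop(2)[OF ef(2)]]])
    qed
  qed
qed

definition slot_points :: "nat \<Rightarrow> (nat \<Rightarrow> nat set) \<Rightarrow> nat \<Rightarrow> nat \<Rightarrow> (nat \<times> nat) list \<Rightarrow> int list list" where
  "slot_points d F K n es = map (\<lambda>j. pair_point d F (slot K n es j)) [0..<(K + 1) * n]"

lemma mst_dim_pos: "N \<ge> 2 \<Longrightarrow> mst_dim N > 0"
  unfolding mst_dim_def by simp

text \<open>The coordinates are -1, 0 and 1, which fit into two signed bits; hence the parameter
  2.\<close>

lemma slot_points_mst_instance:
  assumes es: "es \<in> graph_instances K n" and N: "(K + 1) * n \<ge> 2" "N = (K + 1) * n"
    and F: "separating_family N (mst_dim N) F"
  shows "slot_points (mst_dim N) F K n es \<in> mst_instances (N, 2)"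
proof -
  let ?d = "mst_dim N"
  let ?W = "slot K n es ` {..<N}"
  have "inj_on (real_point ?d F) ?W"
    using slot_subset[OF es] N mst_dim_pos by (intro inj_on_real_point[OF F]) auto
  then have "inj_on (pair_point ?d F) ?W" by (auto simp: inj_on_def)
  then have "inj_on (pair_point ?d F \<circ> slot K n es) {..<N}"
    using inj_on_slot[OF es] N(2) by (intro comp_inj_on) auto
  then have "distinct (slot_points ?d F K n es)"
    unfolding slot_points_def by (simp add: distinct_map N(2) o_def lessThan_atLeast0)
  moreover have "set x \<subseteq> {-2..<2}" if "x \<in> set (slot_points ?d F K n es)" for x
    using that by (auto simp: slot_points_def dest: set_pair_point[THEN subsetD])
  ultimately show ?thesis
    by (auto simp: mst_instances_def slot_points_def N(2))
qed

lemma mst_cost_slot_points: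
  assumes es: "es \<in> graph_instances K n" and N: "(K + 1) * n \<ge> 2" "N = (K + 1) * n"
    and F: "separating_family N (mst_dim N) F"
  shows "mst_cost (map real_of_int ` set (slot_points (mst_dim N) F K n es)) = real (N - 1) \<longleftrightarrow>
    connected_graph {..<n} {{u, v} | u v. (u, v) \<in> set es}"
proof -
  let ?d = "mst_dim N"
  define W where "W = slot K n es ` {..<N}"
  have sub: "W \<subseteq> {(u, v). u \<le> v \<and> v < N}"
    using slot_subset[OF es] by (auto simp: W_def N(2))
  have "W \<noteq> {}" using N(1) unfolding W_def N(2) by (auto simp: lessThan_empty_iff)
  have card: "card W = N"
    unfolding W_def using inj_on_slot[OF es] N(2) by (simp add: card_image)
  have "map real_of_int ` set (slot_points ?d F K n es) = real_point ?d F ` W"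
    unfolding slot_points_def W_def by (simp add: image_image lessThan_atLeast0 N(2))
  then show ?thesis
    using mst_cost_pairs[OF F sub _ \<open>W \<noteq> {}\<close>] connected_slots[OF es, of W] mst_dim_pos[of N] N card
    by (simp add: W_def)
qed


subsection \<open>Local preprocessing of the input\<close>

text \<open>The cardinality is the rank of \<open>j\<close> in \<open>I\<close>, that is, the
  position of item \<open>j\<close> in the list that its machine holds.\<close>

lemma nths_nth:
  assumes "j < length xs" "j \<in> I"
  shows "nths xs I ! card {k. k < j \<and> k \<in> I} = xs ! j"
proof -
  have "xs = take j xs @ xs ! j # drop (Suc j) xs"
    using assms(1) by (rule id_take_nth_drop)
  then have "nths xs I = nths (take j xs @ xs ! j # drop (Suc j) xs) I" by simp
  also have "\<dots> = nths (take j xs) I @ xs ! j # nths (drop (Suc j) xs) {k. Suc k + j \<in> I}"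
    using assms by (simp add: nths_append nths_Cons)
  finally have *: "nths xs I = nths (take j xs) I @ xs ! j # nths (drop (Suc j) xs) {k. Suc k + j \<in> I}" .
  have "length (nths (take j xs) I) = card {k. k < j \<and> k \<in> I}"
    using assms(1) by (simp add: length_nths)
  then show ?thesis unfolding * by (metis nth_append_length)
qed

text \<open>A machine can thus tell from the length of its own list whether slot \<open>j\<close>
  holds an input edge or a filler, without knowing the total number of edges.\<close>

lemma less_length_nths_iff:
  assumes "j \<in> I"
  shows "card {k. k < j \<and> k \<in> I} < length (nths xs I) \<longleftrightarrow> j < length xs"
proof
  assume "j < length xs"
  then have "{k. k < j \<and> k \<in> I} \<subset> {k. k < length xs \<and> k \<in> I}" using assms by auto
  then show "card {k. k < j \<and> k \<in> I} < length (nths xs I)"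
    unfolding length_nths by (rule psubset_card_mono[rotated]) simp
next
  assume less: "card {k. k < j \<and> k \<in> I} < length (nths xs I)"
  show "j < length xs"
  proof (rule ccontr)
    assume "\<not> j < length xs"
    then have "{k. k < length xs \<and> k \<in> I} \<subseteq> {k. k < j \<and> k \<in> I}" by auto
    then have "length (nths xs I) \<le> card {k. k < j \<and> k \<in> I}"
      unfolding length_nths by (rule card_mono[rotated]) simp
    with less show False by simp
  qed
qed

text \<open>
  The machine that holds the items with indices in \<open>I\<close> knows only \<open>L = nths es I\<close>; this
  determines the slots with indices in \<open>I\<close>.
\<close>

definition local_slot :: "nat \<Rightarrow> nat \<Rightarrow> nat set \<Rightarrow> (nat \<times> nat) list \<Rightarrow> nat \<Rightarrow> nat \<times> nat" where
  "local_slot K n I L j = (let q = card {k. k < j \<and> k \<in> I} in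
     if q < length L then L ! q else slot K n [] j)"

definition local_points ::
    "nat \<Rightarrow> (nat \<Rightarrow> nat set) \<Rightarrow> nat \<Rightarrow> nat \<Rightarrow> nat set \<Rightarrow> (nat \<times> nat) list \<Rightarrow> int list list" where
  "local_points d F K n I L =
     map (\<lambda>j. pair_point d F (local_slot K n I L j)) (nths [0..<(K + 1) * n] I)"

lemma nths_slot_points: "nths (slot_points d F K n es) I = local_points d F K n I (nths es I)"
proof -
  have "local_slot K n I (nths es I) j = slot K n es j" if "j \<in> I" for j
    using that by (simp add: local_slot_def Let_def less_length_nths_iff nths_nth slot_def)
  then show ?thesis
    unfolding slot_points_def local_points_def nths_map
    by (intro map_cong) (auto simp: set_nths)
qed

section \<open>A first round that recodes the input locally\<close>

fun unpair :: "nat list \<Rightarrow> (nat \<times> nat) list" where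
  "unpair (u # v # ws) = (u, v) # unpair ws"
| "unpair _ = []"

lemma unpair_encode_edge: "unpair (concat (map (encode_edge n w) es)) = es"
  by (induction es) (auto simp: encode_edge_def)

text \<open>In round 0 every machine applies \<open>g\<close> to its memory and sends nothing; then
  \<open>A\<close> runs with its round numbers shifted by one. The memory size \<open>s\<close> is a
  parameter because the raw input may need more words on a machine than the recoded one.\<close>

definition preprocess :: "'o mpc \<Rightarrow> (nat \<Rightarrow> nat list \<Rightarrow> nat list) \<Rightarrow> nat \<Rightarrow> ('o \<Rightarrow> 'p) \<Rightarrow> 'p mpc" where
  "preprocess A g s h = \<lparr>num_machines = num_machines A, mem_words = s, word_bits = word_bits A,
     num_rounds = Suc (num_rounds A),
     send = (\<lambda>r i x j. case r of 0 \<Rightarrow> [] | Suc r' \<Rightarrow> send A r' i x j),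
     update = (\<lambda>r i x inbox. case r of 0 \<Rightarrow> g i x | Suc r' \<Rightarrow> update A r' i x inbox),
     result = (\<lambda>x. h (result A x))\<rparr>"

lemma preprocess_simps [simp]:
  "num_machines (preprocess A g s h) = num_machines A"
  "mem_words (preprocess A g s h) = s"
  "word_bits (preprocess A g s h) = word_bits A"
  "num_rounds (preprocess A g s h) = Suc (num_rounds A)"
  "send (preprocess A g s h) 0 i x j = []"
  "send (preprocess A g s h) (Suc r) i x j = send A r i x j"
  "update (preprocess A g s h) 0 i x inbox = g i x"
  "update (preprocess A g s h) (Suc r) i x inbox = update A r i x inbox"
  "result (preprocess A g s h) x = h (result A x)"
  by (simp_all add: preprocess_def)

lemma is_words_preprocess [simp]: "is_words (preprocess A g s h) = is_words A"
  by (simp add: is_words_def fun_eq_iff)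

lemma memory_preprocess:
  assumes "\<And>i. g i (memory A input 0 i) = memory A input' 0 i"
  shows "memory (preprocess A g s h) input (Suc r) = memory A input' r"
proof (induction r)
  case 0
  then show ?case using assms by (simp add: fun_eq_iff)
next
  case (Suc r)
  show ?case
    by (subst memory.simps(2)) (simp only: Suc preprocess_simps memory.simps(2)[of A])
qed

text \<open>Only the initial memory, still holding the raw input, needs the separate bound
  \<open>init\<close>; all later memories and messages are those of \<open>A\<close> on
  \<open>input'\<close>, one round earlier.\<close>

lemma computes_preprocess:
  assumes g: "\<And>i. g i (memory A input 0 i) = memory A input' 0 i"
    and A: "computes A input' y" and s: "mem_words A \<le> s"
    and init: "\<And>i. i < num_machines A \<Longrightarrow>
      is_words A (memory A input 0 i) \<and> length (memory A input 0 i) \<le> s"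
  shows "computes (preprocess A g s h) input (h y)"
proof -
  let ?B = "preprocess A g s h"
  note mem = memory_preprocess[where A = A and g = g and input = input and input' = input', OF g]
  have limits: "respects_limits A input'" using A by (simp add: computes_def)
  have msg0: "message ?B input 0 i j = []" for i j by (simp add: message_def)
  have msg: "message ?B input (Suc r) i j = message A input' r i j" for r i j
    by (simp only: message_def mem preprocess_simps)
  have "is_words ?B (memory ?B input r i) \<and> length (memory ?B input r i) \<le> s"
    if "r \<le> Suc (num_rounds A)" "i < num_machines A" for r i
  proof (cases r)
    case 0
    then show ?thesis using init[OF that(2)] by simp
  next
    case (Suc r')
    then have "is_words A (memory A input' r' i) \<and> length (memory A input' r' i) \<le> mem_words A"
      using limits that by (simp add: respects_limits_def)
    then show ?thesis using s unfolding Suc mem by simp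
  qed
  moreover have "(\<forall>j<num_machines A. is_words A (message ?B input r i j)) \<and>
      (\<Sum>j<num_machines A. length (message ?B input r i j)) \<le> s \<and>
      (\<Sum>j<num_machines A. length (message ?B input r j i)) \<le> s"
    if "r < Suc (num_rounds A)" "i < num_machines A" for r i
  proof (cases r)
    case 0
    then show ?thesis by (simp add: msg0 is_words_def)
  next
    case (Suc r')
    then have "(\<forall>j<num_machines A. is_words A (message A input' r' i j)) \<and>
      (\<Sum>j<num_machines A. length (message A input' r' i j)) \<le> mem_words A \<and>
      (\<Sum>j<num_machines A. length (message A input' r' j i)) \<le> mem_words A"
      using limits that by (simp add: respects_limits_def)
    then show ?thesis using s unfolding Suc msg by (meson order_trans)
  qed
  ultimately have "respects_limits ?B input"
    unfolding respects_limits_def preprocess_simps is_words_preprocess by blast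
  moreover have "result ?B (memory ?B input (num_rounds ?B) 0) = h y"
    using A unfolding computes_def preprocess_simps mem by simp
  ultimately show ?thesis by (simp add: computes_def)
qed


subsection \<open>The reduction\<close>

lemma mst_size_bounds:
  assumes "N \<ge> 2"
  shows "N \<le> mst_size (N, 2)" and "mst_size (N, 2) \<le> 202 * N"
proof -
  let ?l = "log 2 (real N)"
  let ?x = "real (N * mst_dim N * 2) / ?l"
  have l: "1 \<le> ?l" using assms by simp
  have d: "100 * ?l \<le> real (mst_dim N)" "real (mst_dim N) \<le> 100 * ?l + 1"
    unfolding mst_dim_def using l by linarith+
  have "real N * ?l \<le> real (N * mst_dim N * 2)"
  proof -
    have "real N * ?l \<le> real N * (real (mst_dim N) * 2)"
      using d l by (intro mult_left_mono) auto
    then show ?thesis by (simp add: mult_ac)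
  qed
  then have lower: "real N \<le> ?x" using l by (simp add: pos_le_divide_eq)
  then have "int N \<le> \<lceil>?x\<rceil>" by linarith
  then show "N \<le> mst_size (N, 2)" unfolding mst_size_def split_conv by linarith
  \<comment> \<open>The constant is \<open>2 * (100 + 1)\<close>: the rounding in
    \<open>mst_dim\<close> costs at most 1, and \<open>1 \<le> log 2 N\<close>.\<close>
  have "real (N * mst_dim N * 2) \<le> real (202 * N) * ?l"
  proof -
    have "real N * (real (mst_dim N) * 2) \<le> real N * (202 * ?l)"
      using d l by (intro mult_left_mono) auto
    then show ?thesis by (simp add: mult_ac)
  qed
  then have "?x \<le> real (202 * N)" using l by (simp add: pos_divide_le_eq)
  then have "\<lceil>?x\<rceil> \<le> int (202 * N)" by linarith
  then show "mst_size (N, 2) \<le> 202 * N" unfolding mst_size_def split_conv by linarith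
qed

lemma length_le_length_concat:
  assumes "\<And>x. x \<in> set xs \<Longrightarrow> f x \<noteq> []"
  shows "length xs \<le> length (concat (map f xs))"
  using assms
proof (induction xs)
  case (Cons x xs)
  then have "length (f x) \<ge> 1" by (simp add: Suc_le_eq)
  then show ?case using Cons by simp
qed simp

lemma connectivity_from_mst_algorithm:
  fixes A :: "real mpc"
  assumes n: "n \<ge> 2" and N: "N = (K + 1) * n"
    and w: "log 2 (real (mst_size (N, 2))) \<le> real (word_bits A)"
    and A: "\<And>ps y. (ps, y) \<in> mst_task (N, 2) \<Longrightarrow>
      computes A (map (encode_point (N, 2) (word_bits A)) ps) y"
  shows "\<exists>B :: bool mpc. num_machines B = num_machines A \<and> mem_words B = 2 * mem_words A \<and>
    word_bits B = word_bits A \<and> num_rounds B = Suc (num_rounds A) \<and>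
    (\<forall>(es, y) \<in> connectivity_task K n. computes B (map (encode_edge n (word_bits B)) es) y)"
proof -
  let ?d = "mst_dim N" and ?w = "word_bits A" and ?M = "num_machines A"
  have N2: "N \<ge> n" "N \<ge> 2" "(K + 1) * n \<ge> 2" using n by (auto simp: N)
  obtain F where F: "separating_family N ?d F"
    using ex_separating_family_mst_dim[OF N2(2)] by blast
  \<comment> \<open>Vertex names have to be legal words of \<open>A\<close>. Its words have at least
    \<open>log 2 (mst_size (N, 2))\<close> bits and this size is at least \<open>n\<close>, so names
    below \<open>n\<close> fit.\<close>
  have "log 2 2 \<le> log 2 (real n)" using n by (subst log_le_cancel_iff) auto
  then have log_n: "1 \<le> log 2 (real n)" by simp
  have "log 2 (real n) \<le> log 2 (real (mst_size (N, 2)))"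
    using mst_size_bounds(1)[OF N2(2)] N2 n by (subst log_le_cancel_iff) auto
  then have log_n_w: "log 2 (real n) \<le> real ?w" using w by linarith
  then have w_pos: "?w > 0" using log_n by linarith
  have "real n = 2 powr log 2 (real n)" using n by simp
  also have "\<dots> \<le> 2 powr real ?w" using log_n_w by (intro powr_mono) auto
  also have "\<dots> = real (2 ^ ?w)" by (simp add: powr_realpow)
  finally have n_le: "n \<le> 2 ^ ?w" by (simp only: of_nat_le_iff)
  define I where "I i = {j. j mod ?M = i}" for i
  define g where "g i x = concat (map (encode_point (N, 2) ?w) (local_points ?d F K n (I i) (unpair x)))"
    for i x
  define B where "B = preprocess A g (2 * mem_words A) (\<lambda>c. c = real (N - 1))"
  have "computes B (map (encode_edge n ?w) es) y" if "(es, y) \<in> connectivity_task K n" for es y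
  proof -
    have es: "es \<in> graph_instances K n"
      and y: "y = connected_graph {..<n} {{u, v} | u v. (u, v) \<in> set es}"
      using that by (auto simp: connectivity_task_def)
    define ps where "ps = slot_points ?d F K n es"
    define c where "c = mst_cost (map real_of_int ` set ps)"
    let ?in = "map (encode_edge n ?w) es" and ?in' = "map (encode_point (N, 2) ?w) ps"
    have inst: "ps \<in> mst_instances (N, 2)"
      unfolding ps_def by (rule slot_points_mst_instance[OF es N2(3) N F])
    then have "(ps, c) \<in> mst_task (N, 2)" by (auto simp: mst_task_def c_def)
    then have comp: "computes A ?in' c" by (rule A)
    have mem: "memory A ?in 0 i = concat (map (encode_edge n ?w) (nths es (I i)))" for i
      by (simp add: I_def nths_map)
    have mem': "memory A ?in' 0 i = concat (map (encode_point (N, 2) ?w) (nths ps (I i)))" for i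
      by (simp add: I_def nths_map)
    have "computes B ?in (c = real (N - 1))"
      unfolding B_def
    proof (rule computes_preprocess[OF _ comp])
      show "g i (memory A ?in 0 i) = memory A ?in' 0 i" for i
        unfolding g_def mem mem' unpair_encode_edge by (simp only: ps_def nths_slot_points)
      show "mem_words A \<le> 2 * mem_words A" by simp
      fix i assume i: "i < ?M"
      have "\<forall>e\<in>set (nths es (I i)). fst e < n \<and> snd e < n"
        using es by (fastforce simp: graph_instances_def dest: in_set_nthsD)
      then have "is_words A (memory A ?in 0 i)"
        unfolding mem is_words_def using n_le by (fastforce simp: encode_edge_def)
      \<comment> \<open>An edge takes two words, while its point takes at least one word on the same
        machine. As the points fit into the memory of \<open>A\<close>, twice that memory holds the
        edges.\<close>
      moreover have "length (memory A ?in 0 i) \<le> 2 * mem_words A"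
      proof -
        have len: "length es \<le> length ps"
          using es N by (simp add: graph_instances_def ps_def slot_points_def)
        have "length (memory A ?in 0 i) = 2 * length (nths es (I i))"
          unfolding mem by (induction "nths es (I i)") (auto simp: encode_edge_def length_concat o_def split_def sum_list_triv)
        moreover have "length (nths es (I i)) \<le> length (nths ps (I i))"
          unfolding length_nths using len by (intro card_mono) auto
        moreover have "encode_point (N, 2) ?w p \<noteq> []" if "p \<in> set (nths ps (I i))" for p
        proof -
          have "length p = ?d"
            using in_set_nthsD[OF that] inst by (auto simp: mst_instances_def)
          then have "real (length p * 2) / real ?w > 0"
            using w_pos mst_dim_pos[OF N2(2)] by simp
          then show ?thesis by (simp add: encode_point_def Let_def)
        qed
        then have "length (nths ps (I i)) \<le> length (memory A ?in' 0 i)"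
          unfolding mem' by (rule length_le_length_concat)
        moreover have "length (memory A ?in' 0 i) \<le> mem_words A"
          using comp i unfolding computes_def respects_limits_def by blast
        ultimately show ?thesis by linarith
      qed
      ultimately show "is_words A (memory A ?in 0 i) \<and> length (memory A ?in 0 i) \<le> 2 * mem_words A" ..
    qed
    moreover have "(c = real (N - 1)) = y"
      unfolding c_def y ps_def by (rule mst_cost_slot_points[OF es N2(3) N F])
    ultimately show ?thesis by simp
  qed
  then show ?thesis by (intro exI[of _ B]) (auto simp: B_def)
qed

text \<open>For \<open>n = 1\<close> the logarithm is 0, which forces words of zero bits, so the
  reduction does not apply. The edge list is empty and the answer is always true.\<close>

lemma connectivity_one_vertex:
  "\<exists>B :: bool mpc. num_machines B = 1 \<and> mem_words B = 1 \<and> word_bits B = 0 \<and> num_rounds B = 0 \<and>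
    (\<forall>(es, y) \<in> connectivity_task K 1. computes B (map (encode_edge 1 (word_bits B)) es) y)"
proof -
  let ?B = "\<lparr>num_machines = 1, mem_words = 1, word_bits = 0, num_rounds = 0,
    send = (\<lambda>_ _ _ _. []), update = (\<lambda>_ _ _ _. []), result = (\<lambda>_. True)\<rparr>"
  have trivial: "es = [] \<and> y" if "(es, y) \<in> connectivity_task K 1" for es y
  proof -
    have "(u, v) \<notin> set es" for u v
      using that by (fastforce simp: connectivity_task_def graph_instances_def)
    then have "es = []" by (cases es) fastforce+
    then show ?thesis using that by (simp add: connectivity_task_def connected_graph_def)
  qed
  have B: "computes ?B [] True"
    by (simp add: computes_def respects_limits_def is_words_def)
  have "computes ?B (map (encode_edge 1 0) es) y" if "(es, y) \<in> connectivity_task K 1" for es y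
    using B trivial[OF that] by simp
  then show ?thesis by (intro exI[of _ ?B]) auto
qed

section \<open>Constants in the resource bounds\<close>

definition solves_within ::
    "real \<Rightarrow> nat \<Rightarrow> real \<Rightarrow> nat \<Rightarrow> (nat \<Rightarrow> 'x \<Rightarrow> nat list) \<Rightarrow> ('x list \<times> 'o) set \<Rightarrow> 'o mpc \<Rightarrow> bool" where
  "solves_within C R \<alpha> n enc task A \<longleftrightarrow>
     num_machines A \<ge> 1 \<and>
     real n powr \<alpha> \<le> real (mem_words A) \<and>
     real (mem_words A) \<le> C * real n powr \<alpha> \<and>
     real (num_machines A) * real (mem_words A) \<le> C * real n \<and>
     log 2 (real n) \<le> real (word_bits A) \<and>
     real (word_bits A) \<le> C * log 2 (real n) \<and>
     num_rounds A \<le> R \<and>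
     (\<forall>(xs, y) \<in> task. computes A (map (enc (word_bits A)) xs) y)"

lemma constant_rounds_iff:
  "constant_rounds \<alpha> P sz enc task \<longleftrightarrow>
     (\<exists>C R. \<forall>p\<in>P. \<exists>A. solves_within C R \<alpha> (sz p) (enc p) (task p) A)"
  unfolding constant_rounds_def solves_within_def ..

theorem theorem7p1:
  fixes \<alpha> :: real
  assumes "0 < \<alpha>" and "\<alpha> < 1"
    and "mst_in_constant_rounds \<alpha>"
  shows "connectivity_in_constant_rounds \<alpha>"
  unfolding connectivity_in_constant_rounds_def
proof
  fix K
  \<comment> \<open>The coordinate constant 2 admits \<open>b = 2\<close> for every
    \<open>N \<ge> 2\<close>.\<close>
  have "constant_rounds \<alpha> {(N, b). N \<ge> 2 \<and> b \<ge> 1 \<and> real b \<le> real 2 * log 2 (real N)}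
      mst_size encode_point mst_task"
    using assms(3) unfolding mst_in_constant_rounds_def by (rule spec)
  then obtain C :: real and R where mst:
    "\<forall>p\<in>{(N, b). N \<ge> 2 \<and> b \<ge> 1 \<and> real b \<le> real 2 * log 2 (real N)}.
      \<exists>A. solves_within C R \<alpha> (mst_size p) (encode_point p) (mst_task p) A"
    unfolding constant_rounds_iff by (elim exE)
  \<comment> \<open>\<open>D\<close> bounds the blow-up of the input size:
    \<open>mst_size (N, 2) \<le> 202 * N\<close> with \<open>N = (K + 1) * n\<close>. In
    \<open>C'\<close>, the 1 serves the case of one vertex, \<open>2 * \<bar>C\<bar> * D\<close> the
    doubled memory, and \<open>\<bar>C\<bar> * (D + 1)\<close> the word length; the absolute value
    is taken because the sign of \<open>C\<close> is unknown.\<close>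
  define D where "D = 202 * (real K + 1)"
  define C' where "C' = 1 + 2 * \<bar>C\<bar> * (D + 1)"
  have D: "1 \<le> D" by (simp add: D_def)
  have C': "1 \<le> C'" "2 * \<bar>C\<bar> * D \<le> C'" "\<bar>C\<bar> * (D + 1) \<le> C'"
    using D by (auto simp: C'_def algebra_simps)
  have "\<exists>B. solves_within C' (Suc R) \<alpha> n (encode_edge n) (connectivity_task K n) B"
    if "n \<ge> 1" for n
  proof (cases "n = 1")
    case True
    obtain B :: "bool mpc" where "num_machines B = 1" "mem_words B = 1" "word_bits B = 0" "num_rounds B = 0"
      "\<forall>(es, y) \<in> connectivity_task K 1. computes B (map (encode_edge 1 (word_bits B)) es) y"
      using connectivity_one_vertex by blast
    then have "solves_within C' (Suc R) \<alpha> n (encode_edge n) (connectivity_task K n) B"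
      using C'(1) unfolding True solves_within_def by simp
    then show ?thesis ..
  next
    case False
    then have n: "n \<ge> 2" using that by simp
    define N where "N = (K + 1) * n"
    define z where "z = mst_size (N, 2)"
    have N: "N \<ge> n" "N \<ge> 2" using n by (auto simp: N_def)
    have log_ge: "1 \<le> log 2 (real m)" if "m \<ge> 2" for m :: nat
      using that by simp
    have "(N, 2) \<in> {(N, b). N \<ge> 2 \<and> b \<ge> 1 \<and> real b \<le> real 2 * log 2 (real N)}"
      using N(2) log_ge[OF N(2)] by simp
    with mst obtain A where "solves_within C R \<alpha> z (encode_point (N, 2)) (mst_task (N, 2)) A"
      unfolding z_def by blast
    then have A: "num_machines A \<ge> 1" "real z powr \<alpha> \<le> real (mem_words A)"
      "real (mem_words A) \<le> C * real z powr \<alpha>"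
      "real (num_machines A) * real (mem_words A) \<le> C * real z"
      "log 2 (real z) \<le> real (word_bits A)" "real (word_bits A) \<le> C * log 2 (real z)"
      "num_rounds A \<le> R"
      "\<And>ps y. (ps, y) \<in> mst_task (N, 2) \<Longrightarrow> computes A (map (encode_point (N, 2) (word_bits A)) ps) y"
      unfolding solves_within_def by blast+
    obtain B :: "bool mpc" where B: "num_machines B = num_machines A" "mem_words B = 2 * mem_words A"
      "word_bits B = word_bits A" "num_rounds B = Suc (num_rounds A)"
      "\<forall>(es, y) \<in> connectivity_task K n. computes B (map (encode_edge n (word_bits B)) es) y"
      using connectivity_from_mst_algorithm[OF n N_def A(5)[unfolded z_def] A(8)] by blast
    have z: "n \<le> z" "real z \<le> D * real n"
    proof -
      show "n \<le> z" using mst_size_bounds(1)[OF N(2)] N(1) by (simp add: z_def)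
      have "real z \<le> real (202 * N)"
        unfolding z_def by (rule of_nat_mono[OF mst_size_bounds(2)[OF N(2)]])
      then show "real z \<le> D * real n" by (simp add: D_def N_def algebra_simps)
    qed
    have "real n powr \<alpha> \<le> real z powr \<alpha>" using z assms(1) by (intro powr_mono2) auto
    then have lower: "real n powr \<alpha> \<le> real (mem_words B)" using A(2) B(2) by simp
    \<comment> \<open>Monotonicity of the power uses \<open>0 < \<alpha>\<close>; below,
      \<open>D powr \<alpha> \<le> D\<close> uses \<open>\<alpha> < 1\<close> and
      \<open>1 \<le> D\<close>.\<close>
    have "real z powr \<alpha> \<le> (D * real n) powr \<alpha>" using z assms(1) by (intro powr_mono2) auto
    also have "\<dots> = D powr \<alpha> * real n powr \<alpha>" using D by (simp add: powr_mult)
    also have "\<dots> \<le> D * real n powr \<alpha>"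
    proof (rule mult_right_mono)
      have "D powr \<alpha> \<le> D powr 1" using D assms(2) by (intro powr_mono) auto
      then show "D powr \<alpha> \<le> D" using D by simp
    qed simp
    finally have z_powr: "real z powr \<alpha> \<le> D * real n powr \<alpha>" .
    have "real (mem_words A) \<le> \<bar>C\<bar> * real z powr \<alpha>"
      using A(3) by (rule order_trans) (intro mult_right_mono, auto)
    also have "\<dots> \<le> \<bar>C\<bar> * (D * real n powr \<alpha>)" using z_powr by (intro mult_left_mono) auto
    finally have "real (mem_words B) \<le> 2 * \<bar>C\<bar> * D * real n powr \<alpha>" using B(2) by simp
    also have "\<dots> \<le> C' * real n powr \<alpha>" using C'(2) by (intro mult_right_mono) auto
    finally have upper: "real (mem_words B) \<le> C' * real n powr \<alpha>" .
    have "real (num_machines A) * real (mem_words A) \<le> \<bar>C\<bar> * real z"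
      using A(4) by (rule order_trans) (intro mult_right_mono, auto)
    also have "\<dots> \<le> \<bar>C\<bar> * (D * real n)" using z by (intro mult_left_mono) auto
    finally have "real (num_machines B) * real (mem_words B) \<le> 2 * \<bar>C\<bar> * D * real n"
      using B(1,2) by simp
    also have "\<dots> \<le> C' * real n" using C'(2) by (intro mult_right_mono) auto
    finally have total: "real (num_machines B) * real (mem_words B) \<le> C' * real n" .
    have log_nz: "log 2 (real n) \<le> log 2 (real z)"
      using z n by (subst log_le_cancel_iff) auto
    \<comment> \<open>From \<open>D < 2 ^ D\<close>. Since \<open>1 \<le> log 2 n\<close>, the
      additive term \<open>log 2 D\<close> of \<open>log 2 (D * n)\<close> becomes a constant
      multiple of \<open>log 2 n\<close>.\<close>
    have "log 2 D \<le> D"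
      using log_of_power_le[of "202 * (K + 1)" 2 "202 * (K + 1)"]
        less_imp_le[OF of_nat_less_two_power[where 'a = real and n = "202 * (K + 1)"]]
      by (simp add: D_def algebra_simps)
    then have "log 2 D \<le> D * log 2 (real n)"
      using D log_ge[OF n] mult_left_mono[of 1 "log 2 (real n)" D] by linarith
    moreover have "log 2 (real z) \<le> log 2 (D * real n)"
      using z n D by (subst log_le_cancel_iff) auto
    moreover have "log 2 (D * real n) = log 2 D + log 2 (real n)"
      using D n by (simp add: log_mult)
    ultimately have log_z: "log 2 (real z) \<le> (D + 1) * log 2 (real n)"
      by (simp add: algebra_simps)
    have "real (word_bits A) \<le> \<bar>C\<bar> * log 2 (real z)"
      using A(6) log_nz log_ge[OF n] by (elim order_trans) (intro mult_right_mono, auto)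
    also have "\<dots> \<le> \<bar>C\<bar> * ((D + 1) * log 2 (real n))" using log_z by (intro mult_left_mono) auto
    also have "\<dots> \<le> C' * log 2 (real n)"
      using C'(3) log_ge[OF n] mult_right_mono[of "\<bar>C\<bar> * (D + 1)" C' "log 2 (real n)"]
      by (simp add: mult.assoc)
    finally have bits: "real (word_bits B) \<le> C' * log 2 (real n)" using B(3) by simp
    have "log 2 (real n) \<le> real (word_bits B)" using A(5) B(3) log_nz by simp
    then have "solves_within C' (Suc R) \<alpha> n (encode_edge n) (connectivity_task K n) B"
      unfolding solves_within_def using A(1,7) B(1,4,5) lower upper total bits by simp
    then show ?thesis ..
  qed
  then show "constant_rounds \<alpha> {n. n \<ge> 1} (\<lambda>n. n) encode_edge (connectivity_task K)"
    unfolding constant_rounds_iff by blast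
qed

end
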